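(* Let $m,n\in\mathbb{N}$ and let $a$ be an integer with $1\le a\le m+n-2$. Then the dual (with respect to $m,n$) of $T_a\cap R_{n,m}$ is $T_{m+n-1-a}\cap R_{n,m}$. Consequently, for $m=n$, $1\le a\le 2n-2$, and the family $\mathcal{F}=\{S_{i,j}\colon i,j\in\mathbb{Z}_+,\ i+j=a\}$ of double stars, $$\mathrm{ex}(n,n,\mathcal{F})=n^2-\gamma(T_{2n-1-a},n,n),$$ where, writing $k=2n-1-a$, $\gamma(T_k,n,n)$ equals $\frac{kn}{2}$ if $k$ is even; $\frac{k+1}{2}n-\frac{k-1}{2}$ if $k$ is odd and $k\le n$; and $\frac{k-1}{2}n+\left\lceil\frac{n(2n-k+1)}{2(2n-k)}\right\rceil$ if $k$ is odd and $k>n$.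
   Context: $\mathbb{Z}_+=\{0,1,2,\dots\}$, $\mathbb{N}=\{1,2,\dots\}$, $[0,c]=\{0,\dots,c\}$, $R_{a,b}=[0,a-1]\times[0,b-1]$. A zero-set (or Young diagram) is a downward-closed subset of $\mathbb{Z}_+^2$. For $a\in\mathbb{N}$, $T_a=\{(x,y)\in\mathbb{Z}_+^2\colon x+y\le a-1\}$. Young domination: the graph $K_m\Box K_n$ is represented on the vertex set $R_{n,m}=[0,n-1]\times[0,m-1]$, two vertices being adjacent iff they differ in exactly one coordinate. For $v=(j,i)\in R_{n,m}$, $\mathcal{N}^r(v)$ is the set of all $(j',i)\in R_{n,m}$ with $j'\ne j$ and $\mathcal{N}^c(v)$ the set of all $(j,i')\in R_{n,m}$ with $i'\neq i$. For a zero-set $\mathcal{Z}$, $\mathcal{T}(A)=A\cup\{v\in R_{n,m}\setminus A\colon (|\mathcal{N}^r(v)\cap A|,|\mathcal{N}^c(v)\cap A|)\notin\mathcal{Z}\}$ and $\gamma(\mathcal{Z},m,n)=\min\{|A|\colon A\subseteq R_{n,m},\ \mathcal{T}(A)=R_{n,m}\}$. Duality: a convex corner of a Young diagram $\mathcal{Y}$ is a maximal point of $\mathcal{Y}$ in the coordinatewise order; a concave corner is a minimal point of $\mathbb{Z}_+^2\setminus\mathcal{Y}$; $\mathcal{I}_{\mathcal{Y}}$ is the set of concave corners. For a Young diagram $\mathcal{Y}\subseteq R_{n,m}$, its dual is the unique Young diagram $\check{\mathcal{Y}}\subseteq R_{n,m}$ whose set of convex corners is $\{(n-a-1,m-b-1)\colon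 (a,b)\in\mathcal{I}_{\mathcal{Y}},\ 0\le a\le n-1,\ 0\le b\le m-1\}$. Double stars: for integers $p,q\ge0$, $S_{p,q}$ is obtained from disjoint $K_{1,p}$ and $K_{1,q}$ by adding an edge between the center $u$ of $K_{1,p}$ and the center $v$ of $K_{1,q}$ (so $u$ has degree $p+1$ and $v$ degree $q+1$); it is equipped with the bipartition $(X_{p,q},Y_{p,q})$ with $u\in X_{p,q}$, $v\in Y_{p,q}$. For a family $\mathcal{F}$ of double stars, $\mathrm{ex}(m,n,\mathcal{F})$ is the maximum number of edges in a bipartite graph with bipartition $(X,Y)$, $|X|=m$, $|Y|=n$, that contains no $S_{p,q}\in\mathcal{F}$ as a (not necessarily induced) subgraph respecting the bipartitions (with $X_{p,q}$ inside $X$ and $Y_{p,q}$ inside $Y$). *)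

theory Defs
  imports Complex_Main "HOL-Library.Product_Order"
begin

text \<open>Pairs of naturals carry the coordinatewise order of \<^theory>\<open>HOL-Library.Product_Order\<close>.\<close>

definition zero_set :: "(nat \<times> nat) set \<Rightarrow> bool" where
  "zero_set Z \<longleftrightarrow> (\<forall>p\<in>Z. \<forall>q\<le>p. q \<in> Z)"

definition rect :: "nat \<Rightarrow> nat \<Rightarrow> (nat \<times> nat) set" where
  "rect a b = {0..<a} \<times> {0..<b}"

text \<open>The condition is \<open>x + y \<le> a - 1\<close> over the integers, so the set is empty for \<open>a = 0\<close>.\<close>

definition triangle :: "nat \<Rightarrow> (nat \<times> nat) set" where
  "triangle a = {(x, y). x + y < a}"


subsection \<open>Young domination\<close>

definition row_nbrs :: "nat \<Rightarrow> nat \<Rightarrow> nat \<times> nat \<Rightarrow> (nat \<times> nat) set" where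
  "row_nbrs m n v = {w \<in> rect n m. snd w = snd v \<and> fst w \<noteq> fst v}"

definition col_nbrs :: "nat \<Rightarrow> nat \<Rightarrow> nat \<times> nat \<Rightarrow> (nat \<times> nat) set" where
  "col_nbrs m n v = {w \<in> rect n m. fst w = fst v \<and> snd w \<noteq> snd v}"

definition young_step ::
  "(nat \<times> nat) set \<Rightarrow> nat \<Rightarrow> nat \<Rightarrow> (nat \<times> nat) set \<Rightarrow> (nat \<times> nat) set" where
  "young_step Z m n A =
     A \<union> {v \<in> rect n m - A. (card (row_nbrs m n v \<inter> A), card (col_nbrs m n v \<inter> A)) \<notin> Z}"

definition young_gamma :: "(nat \<times> nat) set \<Rightarrow> nat \<Rightarrow> nat \<Rightarrow> nat" where
  "young_gamma Z m n = Min {card A | A. A \<subseteq> rect n m \<and> young_step Z m n A = rect n m}"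


subsection \<open>Duality\<close>

definition convex_corners :: "(nat \<times> nat) set \<Rightarrow> (nat \<times> nat) set" where
  "convex_corners Y = {p \<in> Y. \<forall>q\<in>Y. p \<le> q \<longrightarrow> q = p}"

definition concave_corners :: "(nat \<times> nat) set \<Rightarrow> (nat \<times> nat) set" where
  "concave_corners Y = {p \<in> - Y. \<forall>q\<in>- Y. q \<le> p \<longrightarrow> q = p}"

definition young_dual :: "nat \<Rightarrow> nat \<Rightarrow> (nat \<times> nat) set \<Rightarrow> (nat \<times> nat) set" where
  "young_dual m n Y =
     (THE D. zero_set D \<and> D \<subseteq> rect n m \<and>
        convex_corners D =
          {(n - a - 1, m - b - 1) | a b. (a, b) \<in> concave_corners Y \<and> a < n \<and> b < m})"


subsection \<open>Bipartite graphs and double stars\<close>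

record 'v bigraph =
  lside :: "'v set"
  rside :: "'v set"
  edges :: "'v set set"

definition wf_bigraph :: "'v bigraph \<Rightarrow> bool" where
  "wf_bigraph G \<longleftrightarrow> finite (lside G) \<and> finite (rside G) \<and> lside G \<inter> rside G = {} \<and>
     edges G \<subseteq> {{x, y} | x y. x \<in> lside G \<and> y \<in> rside G}"

definition contains_bigraph :: "'v bigraph \<Rightarrow> 'w bigraph \<Rightarrow> bool" where
  "contains_bigraph G H \<longleftrightarrow>
     (\<exists>f. inj_on f (lside H \<union> rside H) \<and> f ` lside H \<subseteq> lside G \<and> f ` rside H \<subseteq> rside G \<and>
          (\<forall>e\<in>edges H. f ` e \<in> edges G))"

datatype ds_vertex = CenterU | CenterV | LeafU nat | LeafV nat

text \<open>The leaves attached to \<open>u\<close> lie on the side of \<open>v\<close>, and vice versa.\<close>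

definition double_star :: "nat \<Rightarrow> nat \<Rightarrow> ds_vertex bigraph" where
  "double_star p q =
     \<lparr> lside = {CenterU} \<union> LeafV ` {0..<q},
       rside = {CenterV} \<union> LeafU ` {0..<p},
       edges = {{CenterU, CenterV}} \<union> {{CenterU, LeafU i} | i. i < p}
                 \<union> {{CenterV, LeafV i} | i. i < q} \<rparr>"

text \<open>Every finite bipartite graph has an isomorphic copy on natural-number vertices, so it is
  enough to maximize over those.\<close>

definition ex_bip :: "nat \<Rightarrow> nat \<Rightarrow> 'w bigraph set \<Rightarrow> nat" where
  "ex_bip m n F =
     Max {card (edges G) | G :: nat bigraph.
            wf_bigraph G \<and> card (lside G) = m \<and> card (rside G) = n \<and>
            (\<forall>H\<in>F. \<not> contains_bigraph G H)}"

end

theory Submission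
  imports Defs
begin

text \<open>The complement of a dominating set for \<open>T\<^sub>k\<close>, and the edge set of a graph without the double
  stars \<open>S\<^sub>i\<^sub>,\<^sub>j\<close>, \<open>i + j = a = 2 n - 1 - k\<close>, are both exactly the bipartite graphs in which the degrees of
  the two ends of every edge add up to at most \<open>D = a + 1\<close>. Summing this over all edges bounds the
  sum of the squared degrees by \<open>D\<close> times the number of edges, and convexity bounds the number of
  edges; for odd \<open>D \<ge> n\<close> one looks instead at the neighbourhood of a vertex of maximum degree.
  With \<open>t = \<lfloor>D / 2\<rfloor>\<close>, the bounds are attained by graphs with \<open>h\<close> vertices of degree \<open>t + 1\<close> on each
  side, pairwise nonadjacent, and all other degrees equal to \<open>t\<close>.\<close>

section \<open>Duality\<close>

text \<open>Finiteness puts every point below a maximal one, so a finite Young diagram is determined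
  by its convex corners. This gives the uniqueness of the dual.\<close>

lemma zero_set_eq_below_convex_corners:
  assumes "zero_set D" "finite D"
  shows "D = {p. \<exists>q\<in>convex_corners D. p \<le> q}"
proof (intro set_eqI iffI)
  fix p assume "p \<in> D"
  then obtain q where "q \<in> D" "p \<le> q" "\<forall>r\<in>D. q \<le> r \<longrightarrow> q = r"
    using finite_has_maximal2[OF \<open>finite D\<close>] by metis
  then have "q \<in> convex_corners D"
    unfolding convex_corners_def by auto
  with \<open>p \<le> q\<close> show "p \<in> {p. \<exists>q\<in>convex_corners D. p \<le> q}"
    by blast
next
  fix p assume "p \<in> {p. \<exists>q\<in>convex_corners D. p \<le> q}"
  then show "p \<in> D"
    using \<open>zero_set D\<close> unfolding convex_corners_def zero_set_def by blast
qed

lemma finite_rect [simp]: "finite (rect n m)"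
  by (simp add: rect_def)

lemma zero_set_triangle_rect: "zero_set (triangle a \<inter> rect n m)"
  by (fastforce simp: zero_set_def triangle_def rect_def)

lemma concave_corners_triangle_rect:
  assumes "x < n" "y < m" "0 < a"
  shows "(x, y) \<in> concave_corners (triangle a \<inter> rect n m) \<longleftrightarrow> x + y = a"
proof
  assume "(x, y) \<in> concave_corners (triangle a \<inter> rect n m)"
  then have ge: "a \<le> x + y"
    and corner: "\<forall>q\<in>- (triangle a \<inter> rect n m). q \<le> (x, y) \<longrightarrow> q = (x, y)"
    using assms by (auto simp: concave_corners_def triangle_def rect_def)
  have min: "u = x \<and> v = y" if "a \<le> u + v" "u \<le> x" "v \<le> y" for u v
    using bspec[OF corner, of "(u, v)"] that by (auto simp: triangle_def)
  \<comment> \<open>If \<open>x + y\<close> exceeded \<open>a\<close>, lowering a positive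
    coordinate by one would stay outside the triangle. The hypothesis \<open>0 < a\<close> excludes
    the origin.\<close>
  show "x + y = a"
    using ge min[of "x - 1" y] min[of x "y - 1"] \<open>0 < a\<close> by force
next
  assume "x + y = a"
  then show "(x, y) \<in> concave_corners (triangle a \<inter> rect n m)"
    using assms by (auto simp: concave_corners_def triangle_def rect_def)
qed

text \<open>The bound on \<open>b\<close> makes the antidiagonal \<open>x + y = b - 1\<close> meet
  the rectangle. Below that line, one of the two coordinates can be raised by one without leaving
  the diagram.\<close>

lemma convex_corners_triangle_rect:
  assumes "0 < b" "b \<le> m + n - 1" "1 \<le> m" "1 \<le> n"
  shows "convex_corners (triangle b \<inter> rect n m) = {(x, y). x < n \<and> y < m \<and> x + y = b - 1}"
proof (rule set_eqI, clarify, rule iffI)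
  fix x y assume "(x, y) \<in> convex_corners (triangle b \<inter> rect n m)"
  then have xy: "x < n" "y < m" "x + y < b"
    and corner: "\<forall>q\<in>triangle b \<inter> rect n m. (x, y) \<le> q \<longrightarrow> q = (x, y)"
    by (auto simp: convex_corners_def triangle_def rect_def)
  have max: "u = x \<and> v = y" if "u + v < b" "u < n" "v < m" "x \<le> u" "y \<le> v" for u v
    using bspec[OF corner, of "(u, v)"] that by (auto simp: triangle_def rect_def)
  show "(x, y) \<in> {(x, y). x < n \<and> y < m \<and> x + y = b - 1}"
    using xy max[of "Suc x" y] max[of x "Suc y"] assms by force
next
  fix x y assume "(x, y) \<in> {(x, y). x < n \<and> y < m \<and> x + y = b - 1}"
  then show "(x, y) \<in> convex_corners (triangle b \<inter> rect n m)"
    using assms by (auto simp: convex_corners_def triangle_def rect_def)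
qed

text \<open>The reflection \<open>(x, y)\<close> to \<open>(n - x - 1, m - y - 1)\<close> carries
  the antidiagonal of sum \<open>a\<close> to that of sum \<open>m + n - 2 - a\<close>, which holds
  the convex corners of the claimed dual.\<close>

lemma young_dual_triangle:
  assumes "1 \<le> m" "1 \<le> n" "1 \<le> a" "a \<le> m + n - 2"
  shows "young_dual m n (triangle a \<inter> rect n m) = triangle (m + n - 1 - a) \<inter> rect n m"
proof -
  let ?b = "m + n - 1 - a"
  let ?C = "{(n - x - 1, m - y - 1) | x y.
      (x, y) \<in> concave_corners (triangle a \<inter> rect n m) \<and> x < n \<and> y < m}"
  have "?C = {(n - x - 1, m - y - 1) | x y. x + y = a \<and> x < n \<and> y < m}"
    using concave_corners_triangle_rect[of _ n _ m a] assms by fastforce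
  also have "\<dots> = {(x, y). x < n \<and> y < m \<and> x + y = ?b - 1}"
  proof (intro set_eqI iffI; clarify)
    fix x y assume "x < n" "y < m" "x + y = ?b - 1"
    then show "\<exists>u v. (x, y) = (n - u - 1, m - v - 1) \<and> u + v = a \<and> u < n \<and> v < m"
      using assms by (intro exI[of _ "n - x - 1"] exI[of _ "m - y - 1"]) auto
  qed (use assms in auto)
  also have "\<dots> = convex_corners (triangle ?b \<inter> rect n m)"
    using assms by (subst convex_corners_triangle_rect) auto
  finally have C: "convex_corners (triangle ?b \<inter> rect n m) = ?C" ..
  show ?thesis
    unfolding young_dual_def
  proof (rule the_equality)
    show "zero_set (triangle ?b \<inter> rect n m) \<and> triangle ?b \<inter> rect n m \<subseteq> rect n m
        \<and> convex_corners (triangle ?b \<inter> rect n m) = ?C"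
      using C zero_set_triangle_rect by blast
  next
    fix D assume D: "zero_set D \<and> D \<subseteq> rect n m \<and> convex_corners D = ?C"
    then have "finite D"
      by (meson finite_rect finite_subset)
    then have "D = {p. \<exists>q\<in>convex_corners D. p \<le> q}"
      using D by (intro zero_set_eq_below_convex_corners) auto
    also have "convex_corners D = convex_corners (triangle ?b \<inter> rect n m)"
      using C D by argo
    also have "{p. \<exists>q\<in>convex_corners (triangle ?b \<inter> rect n m). p \<le> q} = triangle ?b \<inter> rect n m"
      using zero_set_eq_below_convex_corners[OF zero_set_triangle_rect, of ?b n m] by simp
    finally show "D = triangle ?b \<inter> rect n m" .
  qed
qed

section \<open>Edge sets with bounded degree sums\<close>

text \<open>A bare relation serves as the bipartite graph, so that complements of dominating sets
  and edge sets of a \<open>bigraph\<close> are treated alike.\<close>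

definition degree_sums_le :: "nat \<Rightarrow> ('a \<times> 'b) set \<Rightarrow> bool" where
  "degree_sums_le D B \<longleftrightarrow> (\<forall>(x, y)\<in>B. card (B `` {x}) + card (B\<inverse> `` {y}) \<le> D)"

lemma degree_sums_le_converse: "degree_sums_le D (B\<inverse>) \<longleftrightarrow> degree_sums_le D B"
  by (auto simp: degree_sums_le_def add.commute)

text \<open>Double counting: \<open>x\<close> is the first component of as many pairs as its degree.
  Taking \<open>f\<close> constant counts edges; taking \<open>f\<close> to be the degree gives the
  sum of squares.\<close>

lemma sum_fst_eq_sum_degree:
  fixes f :: "'a \<Rightarrow> nat"
  assumes "finite X" "finite Y" "B \<subseteq> X \<times> Y"
  shows "(\<Sum>p\<in>B. f (fst p)) = (\<Sum>x\<in>X. card (B `` {x}) * f x)"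
proof -
  have "B = Sigma X (\<lambda>x. B `` {x})"
    using assms by auto
  then have "(\<Sum>p\<in>B. f (fst p)) = (\<Sum>(x, y)\<in>Sigma X (\<lambda>x. B `` {x}). f x)"
    by (simp add: case_prod_beta)
  also have "\<dots> = (\<Sum>x\<in>X. \<Sum>y\<in>B `` {x}. f x)"
  proof (rule sum.Sigma[symmetric])
    show "\<forall>x\<in>X. finite (B `` {x})"
      using assms by (auto intro: finite_subset[of _ Y])
  qed (use assms in auto)
  finally show ?thesis by simp
qed

lemma sum_snd_eq_sum_degree:
  fixes f :: "'b \<Rightarrow> nat"
  assumes "finite X" "finite Y" "B \<subseteq> X \<times> Y"
  shows "(\<Sum>p\<in>B. f (snd p)) = (\<Sum>y\<in>Y. card (B\<inverse> `` {y}) * f y)"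
proof -
  have "(\<Sum>p\<in>B. f (snd p)) = (\<Sum>p\<in>B\<inverse>. f (fst p))"
    by (rule sum.reindex_bij_witness[of _ prod.swap prod.swap]) auto
  also have "\<dots> = (\<Sum>y\<in>Y. card (B\<inverse> `` {y}) * f y)"
    using assms by (intro sum_fst_eq_sum_degree[of Y X]) auto
  finally show ?thesis .
qed

lemma card_eq_sum_degree:
  assumes "finite X" "finite Y" "B \<subseteq> X \<times> Y"
  shows "card B = (\<Sum>x\<in>X. card (B `` {x}))" "card B = (\<Sum>y\<in>Y. card (B\<inverse> `` {y}))"
  using sum_fst_eq_sum_degree[OF assms, of "\<lambda>_. 1"] sum_snd_eq_sum_degree[OF assms, of "\<lambda>_. 1"]
  by simp_all

lemma sum_squares_degrees_le:
  assumes "finite X" "finite Y" "B \<subseteq> X \<times> Y" "degree_sums_le D B"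
  shows "(\<Sum>x\<in>X. (card (B `` {x}))\<^sup>2) + (\<Sum>y\<in>Y. (card (B\<inverse> `` {y}))\<^sup>2) \<le> D * card B"
proof -
  have "(\<Sum>x\<in>X. (card (B `` {x}))\<^sup>2) + (\<Sum>y\<in>Y. (card (B\<inverse> `` {y}))\<^sup>2)
      = (\<Sum>p\<in>B. card (B `` {fst p}) + card (B\<inverse> `` {snd p}))"
    using sum_fst_eq_sum_degree[OF assms(1-3), of "\<lambda>x. card (B `` {x})"]
      sum_snd_eq_sum_degree[OF assms(1-3), of "\<lambda>y. card (B\<inverse> `` {y})"]
    by (simp add: sum.distrib power2_eq_square)
  also have "\<dots> \<le> (\<Sum>p\<in>B. D)"
    using assms(4) by (intro sum_mono) (auto simp: degree_sums_le_def)
  finally show ?thesis by (simp add: mult.commute)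
qed

text \<open>Sum \<open>d\<^sup>2 \<ge> (s + t) d - s t\<close>, valid for integers \<open>d\<close> when \<open>s - t \<in> {0, 1}\<close>, over all degrees.\<close>

lemma card_le_of_degree_sums_le:
  fixes s t :: nat
  assumes fin: "finite X" "finite Y" and card: "card X = n" "card Y = n"
    and B: "B \<subseteq> X \<times> Y" "degree_sums_le (s + t) B" and st: "s = t \<or> s = Suc t"
  shows "(s + t) * card B \<le> 2 * n * s * t"
proof -
  have tangent: "int (s + t) * int d - int s * int t \<le> (int d)\<^sup>2" for d
  proof -
    \<comment> \<open>No integer lies strictly between \<open>t\<close> and \<open>s\<close>, so the
      factors never have opposite signs.\<close>
    have "0 \<le> (int d - int s) * (int d - int t)"
      using st by (cases "t < d") (auto intro: mult_nonneg_nonneg mult_nonpos_nonpos)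
    then show ?thesis by (simp add: algebra_simps power2_eq_square)
  qed
  have tangent_sum: "int (s + t) * int (sum f A) - int (card A) * (int s * int t) \<le> int (\<Sum>z\<in>A. (f z)\<^sup>2)"
    for f :: "'c \<Rightarrow> nat" and A
    using sum_mono[of A "\<lambda>z. int (s + t) * int (f z) - int s * int t" "\<lambda>z. (int (f z))\<^sup>2"] tangent
    by (simp add: sum_subtractf sum_distrib_left)
  have "int (s + t) * int (card B) - int n * (int s * int t)
      \<le> int (\<Sum>x\<in>X. (card (B `` {x}))\<^sup>2)"
    using tangent_sum[of "\<lambda>x. card (B `` {x})" X] card_eq_sum_degree(1)[OF fin B(1)] card by simp
  moreover have "int (s + t) * int (card B) - int n * (int s * int t)
      \<le> int (\<Sum>y\<in>Y. (card (B\<inverse> `` {y}))\<^sup>2)"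
    using tangent_sum[of "\<lambda>y. card (B\<inverse> `` {y})" Y] card_eq_sum_degree(2)[OF fin B(1)] card by simp
  moreover have "int (\<Sum>x\<in>X. (card (B `` {x}))\<^sup>2) + int (\<Sum>y\<in>Y. (card (B\<inverse> `` {y}))\<^sup>2)
      \<le> int (s + t) * int (card B)"
    using sum_squares_degrees_le[OF fin B] by (metis of_nat_add of_nat_le_iff of_nat_mult)
  \<comment> \<open>The two lower bounds contain \<open>(s + t) * card B\<close> twice, the upper
    bound once; one copy cancels.\<close>
  ultimately have "int (s + t) * int (card B) \<le> 2 * int n * (int s * int t)"
    by linarith
  then have "int ((s + t) * card B) \<le> int (2 * n * s * t)"
    by (simp add: algebra_simps)
  then show ?thesis
    by linarith
qed

text \<open>The neighbours of a vertex \<open>x0\<close> of maximum degree \<open>\<Delta>\<close> have degree at most \<open>2 t + 1 - \<Delta>\<close>.\<close>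

lemma card_le_of_max_degree:
  assumes fin: "finite X" "finite Y" and card: "card Y = n"
    and B: "B \<subseteq> X \<times> Y" "degree_sums_le (2 * t + 1) B" and n: "n \<le> 2 * t + 3"
    and x0: "card (B `` {x0}) \<ge> t + 1"
    and max: "\<And>y. card (B\<inverse> `` {y}) \<le> card (B `` {x0})"
  shows "card B \<le> (n - 1) * (t + 1)"
proof -
  let ?\<Delta> = "card (B `` {x0})" and ?N = "B `` {x0}"
  obtain e where e: "?\<Delta> = t + 1 + e"
    using x0 le_Suc_ex by blast
  have N: "?N \<subseteq> Y" "finite ?N"
    using B(1) fin(2) by (auto intro: finite_subset[of _ Y])
  then have le_n: "?\<Delta> \<le> n"
    using card fin(2) card_mono by blast
  have deg_N: "card (B\<inverse> `` {y}) + ?\<Delta> \<le> 2 * t + 1" if "y \<in> ?N" for y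
    using B(2) that by (auto simp: degree_sums_le_def)
  \<comment> \<open>Any neighbour of \<open>x0\<close> forces
    \<open>?\<Delta> \<le> 2 * t + 1\<close>, hence \<open>e \<le> t\<close>, and the subtraction
    \<open>t - e\<close> below is exact.\<close>
  have "?N \<noteq> {}"
    using x0 by (metis Suc_eq_plus1 card.empty not_less_eq_eq zero_le)
  then have et: "t + 1 + e \<le> 2 * t + 1"
    using deg_N e by fastforce
  have "card B = (\<Sum>y\<in>Y. card (B\<inverse> `` {y}))"
    using card_eq_sum_degree(2)[OF fin B(1)] .
  also have "\<dots> = (\<Sum>y\<in>?N. card (B\<inverse> `` {y})) + (\<Sum>y\<in>Y - ?N. card (B\<inverse> `` {y}))"
    using sum.subset_diff[OF N(1) fin(2)] by (simp add: add.commute)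
  also have "\<dots> \<le> (\<Sum>y\<in>?N. t - e) + (\<Sum>y\<in>Y - ?N. t + 1 + e)"
    using deg_N e max by (intro add_mono sum_mono) (fastforce, metis)
  also have "\<dots> = (t + 1 + e) * (t - e) + (n - (t + 1 + e)) * (t + 1 + e)"
    using N fin card e by (simp add: card_Diff_subset)
  finally have "int (card B) \<le> int \<dots>"
    by linarith
  also have "\<dots> = (int t + 1 + int e) * (int n - 1 - 2 * int e)"
  proof -
    have "int (t - e) = int t - int e" "int (n - (t + 1 + e)) = int n - (int t + 1 + int e)"
      using et le_n e by auto
    then show ?thesis
      by (simp only: of_nat_add of_nat_mult of_nat_1) (simp add: algebra_simps)
  qed
  \<comment> \<open>Isolates the dependence on \<open>e\<close>: the correction is at most 0 because
    \<open>n \<le> 2 * t + 3\<close>.\<close>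
  also have "\<dots> = (int n - 1) * (int t + 1) + int e * (int n - 3 - 2 * int t - 2 * int e)"
    by (simp add: algebra_simps)
  also have "\<dots> \<le> (int n - 1) * (int t + 1)"
    using n by (simp add: mult_nonneg_nonpos)
  also have "\<dots> = int ((n - 1) * (t + 1))"
    using le_n e by (simp add: of_nat_diff algebra_simps)
  finally show ?thesis by linarith
qed

text \<open>If no left degree exceeds \<open>t\<close>, then \<open>n * t\<close> edges already
  suffice as a bound. Otherwise a vertex of maximum degree over both sides has degree at least
  \<open>t + 1\<close>; if it lies on the right, the converse relation is used.\<close>

lemma card_le_of_odd_degree_sums_le:
  assumes fin: "finite X" "finite Y" and card: "card X = n" "card Y = n"
    and B: "B \<subseteq> X \<times> Y" "degree_sums_le (2 * t + 1) B"
    and n: "n \<le> 2 * t + 3" "t + 1 \<le> n"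
  shows "card B \<le> (n - 1) * (t + 1)"
proof -
  let ?dX = "\<lambda>x. card (B `` {x})" and ?dY = "\<lambda>y. card (B\<inverse> `` {y})"
  have fin_B: "finite B"
    using B(1) fin by (meson finite_SigmaI finite_subset)
  have bX: "\<forall>x. ?dX x < Suc n"
    using card_mono[OF fin(2)] B(1) card(2) by (metis Image_subset le_imp_less_Suc)
  have "B\<inverse> \<subseteq> Y \<times> X"
    using B(1) by auto
  then have bY: "\<forall>y. ?dY y < Suc n"
    using card_mono[OF fin(1)] card(1) by (metis Image_subset le_imp_less_Suc)
  obtain x0 where x0: "\<And>x. ?dX x \<le> ?dX x0"
    using ex_has_greatest_nat[of "\<lambda>_. True" _ ?dX] bX by blast
  obtain y0 where y0: "\<And>y. ?dY y \<le> ?dY y0"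
    using ex_has_greatest_nat[of "\<lambda>_. True" _ ?dY] bY by blast
  consider "?dX x0 \<le> t" | "?dX x0 \<ge> t + 1" "?dY y0 \<le> ?dX x0" | "?dY y0 \<ge> t + 1" "?dX x0 \<le> ?dY y0"
    by linarith
  then show ?thesis
  proof cases
    case 1
    then have "card B \<le> n * t"
      using card_eq_sum_degree(1)[OF fin B(1)] sum_bounded_above[of X ?dX t] x0 card
      by (metis of_nat_id order_trans)
    also have "\<dots> \<le> (n - 1) * (t + 1)"
      using n(2) by (cases n) auto
    finally show ?thesis .
  next
    case 2
    then show ?thesis
      using card_le_of_max_degree[OF fin card(2) B n(1)] y0 order_trans by blast
  next
    case 3
    have "card (B\<inverse>) \<le> (n - 1) * (t + 1)"
    proof (rule card_le_of_max_degree[OF fin(2,1) card(1) _ _ n(1) 3(1)])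
      show "degree_sums_le (2 * t + 1) (B\<inverse>)"
        using B(2) by (simp add: degree_sums_le_converse)
    qed (use B(1) order_trans[OF x0 3(2)] in auto)
    then show ?thesis by simp
  qed
qed


section \<open>Extremal edge sets\<close>

text \<open>With \<open>M = q * N + r\<close>, the numbers \<open>a * N + l\<close> below
  \<open>M\<close> are those with \<open>a < q\<close>, and also \<open>a = q\<close> when
  \<open>l < r\<close>.\<close>

lemma card_mod_eq:
  fixes N M l :: nat
  assumes "l < N"
  shows "card {x. x < M \<and> x mod N = l} = M div N + (if l < M mod N then 1 else 0)"
proof -
  define q r where "q = M div N" and "r = M mod N"
  have M: "M = q * N + r" "r < N"
    using assms by (auto simp: q_def r_def)
  let ?K = "{..<q} \<union> (if l < r then {q} else {})"
  have less_iff: "a * N + l < M \<longleftrightarrow> a \<in> ?K" for a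
  proof -
    consider "Suc a \<le> q" | "a = q" | "Suc q \<le> a"
      by linarith
    then show ?thesis
    proof cases
      case 1
      then have "Suc a * N \<le> q * N"
        by (rule mult_le_mono1)
      then have "a * N + l < q * N + r"
        using assms by simp
      then show ?thesis using 1 M(1) by simp
    next
      case 3
      then have "Suc q * N \<le> a * N"
        by (rule mult_le_mono1)
      then have "q * N + r < a * N + l"
        using M(2) by simp
      then show ?thesis using 3 M(1) by simp
    qed (simp add: M(1))
  qed
  have "{x. x < M \<and> x mod N = l} = (\<lambda>a. a * N + l) ` ?K"
  proof (intro equalityI subsetI)
    fix x assume "x \<in> {x. x < M \<and> x mod N = l}"
    then have "x div N * N + l = x" "x < M"
      using div_mult_mod_eq[of x N] by auto
    then show "x \<in> (\<lambda>a. a * N + l) ` ?K"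
      using less_iff[of "x div N"] by (metis image_eqI)
  qed (use less_iff assms in auto)
  moreover have "inj_on (\<lambda>a. a * N + l) ?K"
    using assms by (intro inj_onI) simp
  ultimately have "card {x. x < M \<and> x mod N = l} = card ?K"
    by (simp only: card_image)
  also have "\<dots> = q + (if l < r then 1 else 0)"
    by simp
  finally show ?thesis
    by (simp only: q_def r_def)
qed

lemma inj_on_add_mod:
  fixes c N :: nat
  shows "inj_on (\<lambda>j. (c + j) mod N) {..<N}"
proof (rule inj_onI)
  fix i j assume "i \<in> {..<N}" "j \<in> {..<N}" "(c + i) mod N = (c + j) mod N"
  then show "i = j"
  proof (induction i j rule: linorder_wlog)
    case (le i j)
    then have "N dvd (c + j) - (c + i)"
      by (metis mod_eq_dvd_iff_nat nat_add_left_cancel_le)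
    then show ?case
      using le by (auto dest: dvd_imp_le)
  qed auto
qed

text \<open>Rotation by \<open>c\<close> permutes the residues, so the preimage of the first
  \<open>d\<close> of them has \<open>d\<close> elements.\<close>

lemma card_add_mod_less:
  fixes c N d :: nat
  assumes "d \<le> N"
  shows "card {j. j < N \<and> (c + j) mod N < d} = d"
proof (cases "N = 0")
  case False
  let ?f = "\<lambda>j. (c + j) mod N"
  have "?f ` {..<N} = {..<N}"
    using False by (intro endo_inj_surj inj_on_add_mod) auto
  then have "?f ` {j. j < N \<and> ?f j < d} = {..<N} \<inter> {..<d}"
    by (auto simp del: mod_less_divisor)
  also have "\<dots> = {..<d}"
    using assms by auto
  finally have "card (?f ` {j. j < N \<and> ?f j < d}) = d"
    by simp
  moreover have "inj_on ?f {j. j < N \<and> ?f j < d}"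
    by (rule inj_on_subset[OF inj_on_add_mod[of c N]]) auto
  ultimately show ?thesis
    by (simp only: card_image)
qed (use assms in auto)

text \<open>Block \<open>i\<close> consists of the \<open>w\<close> cyclically consecutive residues starting at \<open>i w\<close>, so that
  the first \<open>h\<close> blocks cover the residues as evenly as possible.\<close>

definition in_block :: "nat \<Rightarrow> nat \<Rightarrow> nat \<Rightarrow> nat \<Rightarrow> bool" where
  "in_block N w i l \<longleftrightarrow> (\<exists>s<w. (i * w + s) mod N = l)"

lemma card_block:
  assumes "w \<le> N"
  shows "card {l. l < N \<and> in_block N w i l} = w"
proof (cases "N = 0")
  case False
  have "{l. l < N \<and> in_block N w i l} = (\<lambda>s. (i * w + s) mod N) ` {..<w}"
    using False by (auto simp: in_block_def)
  moreover have "inj_on (\<lambda>s. (i * w + s) mod N) {..<w}"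
    by (rule inj_on_subset[OF inj_on_add_mod]) (use assms in auto)
  ultimately show ?thesis
    by (simp add: card_image)
qed (use assms in auto)

text \<open>The positions \<open>i * w + s\<close> with \<open>i < h\<close> and
  \<open>s < w\<close> run through the numbers below \<open>h * w\<close> once each, so the count is
  one of residues equal to \<open>l\<close>. Since \<open>w \<le> N\<close>, no block meets a
  residue twice, and the position is determined by its block.\<close>

lemma card_blocks_containing:
  assumes "l < N" "w \<le> N"
  shows "card {i. i < h \<and> in_block N w i l}
    = (h * w) div N + (if l < (h * w) mod N then 1 else 0)"
proof -
  let ?S = "{x. x < h * w \<and> x mod N = l}"
  have "{i. i < h \<and> in_block N w i l} = (\<lambda>x. x div w) ` ?S"
  proof (intro equalityI subsetI)
    fix i assume "i \<in> {i. i < h \<and> in_block N w i l}"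
    then obtain s where s: "i < h" "s < w" "(i * w + s) mod N = l"
      by (auto simp: in_block_def)
    then have "Suc i * w \<le> h * w"
      by (intro mult_le_mono1) simp
    then have "i * w + s \<in> ?S"
      using s by simp
    moreover have "(i * w + s) div w = i"
      using s(2) by simp
    ultimately show "i \<in> (\<lambda>x. x div w) ` ?S"
      by (intro image_eqI[of _ _ "i * w + s"]) simp_all
  next
    fix i assume "i \<in> (\<lambda>x. x div w) ` ?S"
    then obtain x where x: "i = x div w" "x < h * w" "x mod N = l"
      by auto
    then have "0 < w"
      by (cases w) auto
    then have "x mod w < w" "(i * w + x mod w) mod N = l" "i < h"
      using x by (simp_all add: less_mult_imp_div_less)
    then show "i \<in> {i. i < h \<and> in_block N w i l}"
      by (auto simp: in_block_def)
  qed
  moreover have "inj_on (\<lambda>x. x div w) ?S"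
  proof (rule inj_onI)
    fix x y assume xy: "x \<in> ?S" "y \<in> ?S" and div: "x div w = y div w"
    then have "0 < w"
      by (cases w) auto
    then have "x mod w \<in> {..<N}" "y mod w \<in> {..<N}"
      using assms(2) by (simp_all add: less_le_trans[of _ w N])
    moreover have "(x div w * w + x mod w) mod N = (x div w * w + y mod w) mod N"
      using xy div by (metis (mono_tags, lifting) div_mult_mod_eq mem_Collect_eq)
    ultimately have "x mod w = y mod w"
      using inj_onD[OF inj_on_add_mod] by blast
    then show "x = y"
      using div by (metis div_mult_mod_eq)
  qed
  ultimately show ?thesis
    using card_mod_eq[OF assms(1), of "h * w"] by (simp add: card_image)
qed

text \<open>A \<open>d\<close>-regular cyclic pattern, from which a matching of the first \<open>r\<close> vertices is removed.
  It is made of antidiagonals \<open>i + j = const (mod N)\<close> to be symmetric.\<close>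

definition defective_cyclic :: "nat \<Rightarrow> nat \<Rightarrow> nat \<Rightarrow> nat \<Rightarrow> nat \<Rightarrow> bool" where
  "defective_cyclic N d r i j \<longleftrightarrow>
     (i + j + (N + 1 - r)) mod N < d \<and> \<not> (i < r \<and> j < r \<and> i + j + 1 = r)"

text \<open>The shift \<open>N + 1 - r\<close> places the removed partner \<open>r - 1 - i\<close>
  of \<open>i\<close> at the sum \<open>N\<close>, hence at residue 0. As \<open>0 < d\<close> when
  \<open>r\<close> is positive, that edge was present in the pattern.\<close>

lemma card_defective_cyclic:
  assumes "d \<le> N" "r \<le> N" "r = 0 \<or> 0 < d"
  shows "card {j. j < N \<and> defective_cyclic N d r i j} = d - (if i < r then 1 else 0)"
proof -
  let ?C = "{j. j < N \<and> (i + (N + 1 - r) + j) mod N < d}"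
  let ?M = "if i < r then {r - 1 - i} else {}"
  have C: "finite ?C" "card ?C = d"
    using card_add_mod_less[OF assms(1)] by auto
  have "{j. j < N \<and> defective_cyclic N d r i j} = ?C - ?M"
    by (auto simp: defective_cyclic_def add_ac)
  moreover have "?M \<subseteq> ?C"
    using assms by auto
  ultimately show ?thesis
    using C by (simp add: card_Diff_subset)
qed

text \<open>On each side, vertices below \<open>h\<close> have degree \<open>t + 1\<close> and are joined to blocks of the other
  \<open>N = n - h\<close> vertices; the latter are completed to degree \<open>t\<close> by a cyclic pattern.\<close>

lemma exists_degree_sums_le:
  fixes n h t :: nat
  assumes "t + 1 + h \<le> n" "h * (t + 1) \<le> t * (n - h)"
  obtains B where "B \<subseteq> rect n n" "degree_sums_le (if h = 0 then 2 * t else 2 * t + 1) B"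
    "card B = n * t + h"
proof -
  define N where "N = n - h"
  define q where "q = h * (t + 1) div N"
  define r where "r = h * (t + 1) mod N"
  have N: "t + 1 \<le> N" "n = h + N"
    using assms(1) by (auto simp: N_def)
  have qr: "h * (t + 1) = q * N + r" "r < N"
    using N by (auto simp: q_def r_def)
  have "q * N + r \<le> t * N"
    using assms(2) qr(1) by (simp add: N_def)
  then have "t < q \<Longrightarrow> False"
    using N mult_le_mono1[of "Suc t" q N] by simp
  then have qt: "q \<le> t"
    by (meson not_less)
  \<comment> \<open>If \<open>r > 0\<close>, the cyclic pattern of degree \<open>t - q\<close> has
    an edge to lose at each of its first \<open>r\<close> vertices.\<close>
  then have r_q: "r = 0 \<or> q < t"
    using \<open>q * N + r \<le> t * N\<close> by (cases "q = t") auto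
  \<comment> \<open>Vertex \<open>h + l\<close> receives \<open>q\<close> block edges through
    \<open>P\<close>, and one more exactly when \<open>l < r\<close>. \<open>Q\<close> supplies
    \<open>t - q\<close> edges, one fewer for the same \<open>l\<close>.\<close>
  define P where "P = in_block N (t + 1)"
  define Q where "Q = defective_cyclic N (t - q) r"
  define E where "E i j \<longleftrightarrow> (if i < h then h \<le> j \<and> P i (j - h)
      else if j < h then P j (i - h) else Q (i - h) (j - h))" for i j
  have E_sym: "E i j \<longleftrightarrow> E j i" for i j
    by (auto simp: E_def Q_def defective_cyclic_def add.commute)
  have shift: "{j. j < n \<and> h \<le> j \<and> R (j - h)} = (+) h ` {l. l < N \<and> R l}" for R
    using N(2) by (auto intro!: image_eqI[of _ _ "_ - h"])
  have deg: "card {j. j < n \<and> E i j} = t + (if i < h then 1 else 0)" if "i < n" for i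
  proof (cases "i < h")
    case True
    have "{j. j < n \<and> E i j} = (+) h ` {l. l < N \<and> P i l}"
      using True shift[of "P i"] by (simp add: E_def)
    then show ?thesis
      using True card_block[OF N(1)] by (simp add: card_image P_def)
  next
    case False
    then have l: "i - h < N"
      using that N by auto
    have "{j. j < n \<and> E i j} = {j. j < h \<and> P j (i - h)} \<union> (+) h ` {l. l < N \<and> Q (i - h) l}"
      using False N(2) by (auto simp: E_def simp flip: shift)
    moreover have "card ({j. j < h \<and> P j (i - h)} \<union> (+) h ` {l. l < N \<and> Q (i - h) l})
        = card {j. j < h \<and> P j (i - h)} + card {l. l < N \<and> Q (i - h) l}"
      by (subst card_Un_disjoint) (auto simp: card_image)
    moreover have "card {j. j < h \<and> P j (i - h)} = q + (if i - h < r then 1 else 0)"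
      unfolding P_def q_def r_def by (rule card_blocks_containing[OF l N(1)])
    moreover have "card {l. l < N \<and> Q (i - h) l} = t - q - (if i - h < r then 1 else 0)"
      unfolding Q_def using N qr r_q by (intro card_defective_cyclic) auto
    ultimately have "card {j. j < n \<and> E i j}
        = q + (if i - h < r then 1 else 0) + (t - q - (if i - h < r then 1 else 0))"
      by (simp only:)
    also have "\<dots> = t"
      using qt r_q by (cases "r = 0") auto
    finally show ?thesis
      using False by simp
  qed
  define B where "B = {(i, j). i < n \<and> j < n \<and> E i j}"
  have img: "card (B `` {i}) = t + (if i < h then 1 else 0)" if "i < n" for i
  proof -
    have "B `` {i} = {j. j < n \<and> E i j}"
      using that by (auto simp: B_def)
    then show ?thesis using deg[OF that] by simp
  qed
  have B_sym: "B\<inverse> = B"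
    using E_sym by (auto simp: B_def)
  have sub: "B \<subseteq> rect n n"
    by (auto simp: B_def rect_def)
  have sums: "degree_sums_le (if h = 0 then 2 * t else 2 * t + 1) B"
    unfolding degree_sums_le_def B_sym
  proof clarify
    fix x y assume "(x, y) \<in> B"
    \<comment> \<open>At most one end of an edge has degree \<open>t + 1\<close>, and none does if
      \<open>h = 0\<close>.\<close>
    then have "x < n" "y < n" "\<not> (x < h \<and> y < h)"
      by (auto simp: B_def E_def)
    then show "card (B `` {x}) + card (B `` {y}) \<le> (if h = 0 then 2 * t else 2 * t + 1)"
      by (auto simp: img)
  qed
  have "card B = (\<Sum>x\<in>{0..<n}. card (B `` {x}))"
    using sub by (intro card_eq_sum_degree(1)[of _ "{0..<n}"]) (auto simp: rect_def)
  also have "\<dots> = (\<Sum>x<n. t + (if x < h then 1 else 0))"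
    by (simp add: img lessThan_atLeast0)
  also have "\<dots> = n * t + card ({..<n} \<inter> {x. x < h})"
    by (simp add: sum.distrib sum.If_cases)
  also have "{..<n} \<inter> {x. x < h} = {..<h}"
    using N by auto
  finally have "card B = n * t + h" by simp
  with that sub sums show ?thesis by blast
qed

section \<open>The maximum number of edges\<close>

text \<open>With \<open>t = D div 2\<close> and \<open>D \<le> 2 * n - 1\<close>, the three values
  are \<open>n * t + h\<close> for \<open>h = 0\<close>, \<open>h = n - t - 1\<close> and
  \<open>h = n * t div D\<close>.\<close>

definition max_edges :: "nat \<Rightarrow> nat \<Rightarrow> nat" where
  "max_edges n D =
     (if even D then n * (D div 2)
      else if n \<le> D then (n - 1) * (D div 2 + 1)
      else n * (D div 2) + n * (D div 2) div D)"

lemma card_le_max_edges: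
  assumes fin: "finite X" "finite Y" and card: "card X = n" "card Y = n"
    and B: "B \<subseteq> X \<times> Y" "degree_sums_le D B"
    and D: "2 \<le> D" "D \<le> 2 * n - 1"
  shows "card B \<le> max_edges n D"
proof (cases "even D")
  case True
  then obtain t where t: "D = t + t"
    by (metis evenE mult_2)
  then have "0 < t"
    using D(1) by simp
  then have "(t + t) * card B \<le> 2 * n * t * t"
    using card_le_of_degree_sums_le[OF fin card B(1), of t t] B(2)[unfolded t] by blast
  then have "(t + t) * card B \<le> (t + t) * (n * t)"
    by (simp add: algebra_simps)
  then show ?thesis
    using t \<open>0 < t\<close> True by (simp add: max_edges_def flip: mult_2)
next
  case False
  then obtain t where t: "D = 2 * t + 1"
    by (rule oddE)
  show ?thesis
  proof (cases "n \<le> D")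
    case True
    then have "card B \<le> (n - 1) * (t + 1)"
      using card_le_of_odd_degree_sums_le[OF fin card B(1), of t] B(2) t D by auto
    then show ?thesis
      using t True by (simp add: max_edges_def)
  next
    case False
    have D: "D = Suc t + t"
      using t by simp
    then have "D * card B \<le> 2 * n * Suc t * t"
      using card_le_of_degree_sums_le[OF fin card B(1), of "Suc t" t] B(2) by blast
    \<comment> \<open>Here \<open>2 * (t + 1) = D + 1\<close>; dividing by \<open>D\<close> then
      yields the integer part of the bound.\<close>
    also have "\<dots> = D * (n * t) + n * t"
      using t by (simp add: algebra_simps)
    finally have "card B \<le> (D * (n * t) + n * t) div D"
      using t by (simp add: less_eq_div_iff_mult_less_eq mult.commute)
    also have "\<dots> = n * t + n * t div D"
      by (rule div_mult_self4) (use t in simp)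
    finally show ?thesis
      using False t by (simp add: max_edges_def)
  qed
qed

lemma exists_max_edges:
  assumes D: "2 \<le> D" "D \<le> 2 * n - 1"
  obtains B where "B \<subseteq> rect n n" "degree_sums_le D B" "card B = max_edges n D"
proof (cases "even D")
  case True
  then obtain t where t: "D = 2 * t"
    by (rule evenE)
  then have "t + 1 + 0 \<le> n"
    using D by linarith
  then obtain B where "B \<subseteq> rect n n" "degree_sums_le D B" "card B = n * t"
    using exists_degree_sums_le[of t 0 n] t by auto
  then show ?thesis
    using that t by (simp add: max_edges_def)
next
  case False
  then obtain t where t: "D = 2 * t + 1"
    by (rule oddE)
  then have tn: "t + 1 \<le> n"
    using D by linarith
  \<comment> \<open>\<open>h\<close> is read off from the excess of \<open>max_edges n D\<close>
    over \<open>n * t\<close>.\<close>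
  define h where "h = (if n \<le> D then n - t - 1 else n * t div D)"
  have "t + 1 + h \<le> n \<and> h * (t + 1) \<le> t * (n - h) \<and> max_edges n D = n * t + h"
  proof (cases "n \<le> D")
    case True
    \<comment> \<open>In this case \<open>n - h = t + 1\<close>, so each block is the whole set of
      the remaining vertices.\<close>
    then have h: "n = t + 1 + h" "h \<le> t"
      using tn t by (auto simp: h_def)
    have "h * (t + 1) \<le> t * (t + 1)"
      using h(2) by (rule mult_le_mono1)
    then show ?thesis
      using h True t by (auto simp: max_edges_def algebra_simps)
  next
    case False
    then have hD: "h * D \<le> n * t"
      by (simp add: h_def)
    \<comment> \<open>The aim is \<open>h * D \<le> n * t < (n - t) * D\<close>, which gives
      \<open>h < n - t\<close>.\<close>
    have "n * D = n * t + n * (t + 1)"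
      using t by (simp add: algebra_simps)
    then have "(n - t) * D = n * t + n * (t + 1) - t * D"
      by (simp only: diff_mult_distrib)
    moreover have "t * D < n * (t + 1)"
    proof -
      have "t * D \<le> n * t"
        using False by (simp add: mult.commute[of t])
      also have "\<dots> < n * (t + 1)"
        using False by simp
      finally show ?thesis .
    qed
    ultimately have "h * D < (n - t) * D"
      using hD by linarith
    then have le: "t + 1 + h \<le> n"
      by auto
    have "h * (t + 1) + t * h \<le> t * n"
      using hD t by (simp add: algebra_simps)
    then have "h * (t + 1) \<le> t * (n - h)"
      by (simp add: diff_mult_distrib2)
    then show ?thesis
      using le False t by (auto simp: max_edges_def h_def)
  qed
  then obtain B where B: "B \<subseteq> rect n n" "degree_sums_le (if h = 0 then 2 * t else 2 * t + 1) B"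
    "card B = max_edges n D"
    using exists_degree_sums_le[of t h n] by metis
  then have "degree_sums_le D B"
    using t by (auto simp: degree_sums_le_def split: if_splits)
  with B that show ?thesis by blast
qed

section \<open>Domination and double stars in terms of degree sums\<close>

text \<open>As the vertex is not in \<open>A\<close>, its row neighbours in \<open>A\<close> are all
  points of \<open>A\<close> in row \<open>y\<close>; the other points of that row are counted by
  the degree of \<open>y\<close> in the complement.\<close>

lemma card_row_nbrs_Int:
  assumes "A \<subseteq> rect n m" "(x, y) \<in> rect n m - A"
  shows "card (row_nbrs m n (x, y) \<inter> A) = n - card ((rect n m - A)\<inverse> `` {y})"
proof -
  let ?N = "(rect n m - A)\<inverse> `` {y}"
  have "row_nbrs m n (x, y) \<inter> A = (\<lambda>x'. (x', y)) ` ({0..<n} - ?N)"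
    using assms by (auto simp: row_nbrs_def rect_def)
  moreover have "?N \<subseteq> {0..<n}"
    by (auto simp: rect_def)
  then have "card ({0..<n} - ?N) = n - card ?N"
    by (simp add: card_Diff_subset finite_subset)
  ultimately show ?thesis
    by (simp add: card_image inj_on_def)
qed

lemma card_col_nbrs_Int:
  assumes "A \<subseteq> rect n m" "(x, y) \<in> rect n m - A"
  shows "card (col_nbrs m n (x, y) \<inter> A) = m - card ((rect n m - A) `` {x})"
proof -
  let ?N = "(rect n m - A) `` {x}"
  have "col_nbrs m n (x, y) \<inter> A = Pair x ` ({0..<m} - ?N)"
    using assms by (auto simp: col_nbrs_def rect_def)
  moreover have "?N \<subseteq> {0..<m}"
    by (auto simp: rect_def)
  then have "card ({0..<m} - ?N) = m - card ?N"
    by (simp add: card_Diff_subset finite_subset)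
  ultimately show ?thesis
    by (simp add: card_image inj_on_def)
qed

lemma card_Image_rect_le:
  assumes "B \<subseteq> rect n m"
  shows "card (B `` {x}) \<le> m" "card (B\<inverse> `` {y}) \<le> n"
proof -
  have "B `` {x} \<subseteq> {0..<m}" "B\<inverse> `` {y} \<subseteq> {0..<n}"
    using assms by (auto simp: rect_def)
  then show "card (B `` {x}) \<le> m" "card (B\<inverse> `` {y}) \<le> n"
    using card_mono[of "{0..<m}"] card_mono[of "{0..<n}"] by fastforce+
qed

text \<open>A vertex outside \<open>A\<close> whose column and row have complement degrees
  \<open>d\<close> and \<open>d'\<close> sees \<open>n - d'\<close> and \<open>m - d\<close> members
  of \<open>A\<close>. These sum to at least \<open>k\<close> iff
  \<open>d + d' \<le> m + n - k\<close>; no subtraction truncates.\<close>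

lemma young_step_triangle_eq_rect_iff:
  assumes "A \<subseteq> rect n m" "k \<le> m + n"
  shows "young_step (triangle k) m n A = rect n m \<longleftrightarrow> degree_sums_le (m + n - k) (rect n m - A)"
proof -
  let ?B = "rect n m - A"
  have "young_step (triangle k) m n A = rect n m \<longleftrightarrow>
      (\<forall>v\<in>?B. (card (row_nbrs m n v \<inter> A), card (col_nbrs m n v \<inter> A)) \<notin> triangle k)"
    using assms(1) unfolding young_step_def by blast
  also have "\<dots> \<longleftrightarrow> (\<forall>(x, y)\<in>?B. card (?B `` {x}) + card (?B\<inverse> `` {y}) \<le> m + n - k)"
  proof (intro ball_cong refl, clarify)
    fix x y assume "(x, y) \<in> rect n m" "(x, y) \<notin> A"
    moreover have "card (?B `` {x}) \<le> m" "card (?B\<inverse> `` {y}) \<le> n"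
      using card_Image_rect_le[of ?B n m] by auto
    ultimately show "(card (row_nbrs m n (x, y) \<inter> A), card (col_nbrs m n (x, y) \<inter> A)) \<notin> triangle k
        \<longleftrightarrow> card (?B `` {x}) + card (?B\<inverse> `` {y}) \<le> m + n - k"
      using assms by (auto simp: triangle_def card_row_nbrs_Int card_col_nbrs_Int)
  qed
  finally show ?thesis
    by (simp only: degree_sums_le_def)
qed

text \<open>Complementation in the square turns minimum dominating sets into maximum edge sets with
  \<open>D = 2 * n - k\<close>. The first claim makes the subtraction in the second exact.\<close>

lemma young_gamma_triangle:
  assumes "1 \<le> k" "k \<le> 2 * n - 2"
  shows "max_edges n (2 * n - k) \<le> n * n"
    "young_gamma (triangle k) n n = n * n - max_edges n (2 * n - k)"
proof -
  let ?D = "2 * n - k"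
  have D: "2 \<le> ?D" "?D \<le> 2 * n - 1"
    using assms by auto
  have card_rect: "card (rect n n) = n * n"
    by (simp add: rect_def)
  have iff: "young_step (triangle k) n n A = rect n n \<longleftrightarrow> degree_sums_le ?D (rect n n - A)"
    if "A \<subseteq> rect n n" for A
    using young_step_triangle_eq_rect_iff[OF that, of k] assms by (simp add: mult_2)
  obtain B where B: "B \<subseteq> rect n n" "degree_sums_le ?D B" "card B = max_edges n ?D"
    using exists_max_edges[OF D] .
  then show "max_edges n ?D \<le> n * n"
    using card_mono[OF finite_rect B(1)] card_rect by simp
  show "young_gamma (triangle k) n n = n * n - max_edges n ?D"
    unfolding young_gamma_def
  proof (rule Min_eqI)
    have "{card A |A. A \<subseteq> rect n n \<and> young_step (triangle k) n n A = rect n n} \<subseteq> card ` Pow (rect n n)"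
      by auto
    then show "finite {card A |A. A \<subseteq> rect n n \<and> young_step (triangle k) n n A = rect n n}"
      by (rule finite_subset) simp
  next
    fix c assume "c \<in> {card A |A. A \<subseteq> rect n n \<and> young_step (triangle k) n n A = rect n n}"
    then obtain A where A: "c = card A" "A \<subseteq> rect n n" "degree_sums_le ?D (rect n n - A)"
      using iff by auto
    have "card (rect n n - A) \<le> max_edges n ?D"
      by (rule card_le_max_edges[of "{0..<n}" "{0..<n}"]) (use A D in \<open>auto simp: rect_def\<close>)
    moreover have "card (rect n n - A) = n * n - card A"
      using A(2) card_rect by (simp add: card_Diff_subset finite_subset[OF _ finite_rect])
    ultimately show "n * n - max_edges n ?D \<le> c"
      using A(1) by linarith
  next
    have "rect n n - (rect n n - B) = B"
      using B(1) by auto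
    moreover have "card (rect n n - B) = n * n - max_edges n ?D"
      using B card_rect by (simp add: card_Diff_subset finite_subset[OF _ finite_rect])
    ultimately show "n * n - max_edges n ?D
        \<in> {card A |A. A \<subseteq> rect n n \<and> young_step (triangle k) n n A = rect n n}"
      using B(2) iff[of "rect n n - B"] by fastforce
  qed
qed

section \<open>Double stars in bipartite graphs\<close>

definition edge_pairs :: "'v bigraph \<Rightarrow> ('v \<times> 'v) set" where
  "edge_pairs G = {(x, y). x \<in> lside G \<and> y \<in> rside G \<and> {x, y} \<in> edges G}"

lemma edge_pairs_subset: "edge_pairs G \<subseteq> lside G \<times> rside G"
  by (auto simp: edge_pairs_def)

text \<open>Disjoint sides leave only one orientation of each edge from left to right.\<close>

lemma card_edge_pairs:
  assumes "wf_bigraph G"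
  shows "card (edge_pairs G) = card (edges G)"
proof -
  have "edges G = (\<lambda>(x, y). {x, y}) ` edge_pairs G"
    using assms by (fastforce simp: wf_bigraph_def edge_pairs_def)
  moreover have "inj_on (\<lambda>(x, y). {x, y}) (edge_pairs G)"
    using assms by (fastforce intro!: inj_onI simp: wf_bigraph_def edge_pairs_def doubleton_eq_iff)
  ultimately show ?thesis
    by (simp add: card_image)
qed

text \<open>The image of each centre is adjacent to the images of its leaves and of the other
  centre, which are distinct by injectivity.\<close>

lemma contains_double_starD:
  assumes G: "wf_bigraph G" and "contains_bigraph G (double_star p q)"
  obtains x y where "(x, y) \<in> edge_pairs G"
    "p + 1 \<le> card (edge_pairs G `` {x})" "q + 1 \<le> card ((edge_pairs G)\<inverse> `` {y})"
proof -
  let ?H = "double_star p q" and ?E = "edge_pairs G"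
  obtain f where inj: "inj_on f (lside ?H \<union> rside ?H)"
    and l: "f ` lside ?H \<subseteq> lside G" and r: "f ` rside ?H \<subseteq> rside G"
    and e: "\<forall>e\<in>edges ?H. f ` e \<in> edges G"
    using assms(2) by (auto simp: contains_bigraph_def)
  let ?x = "f CenterU" and ?y = "f CenterV"
  let ?P = "insert CenterV (LeafU ` {0..<p})" and ?Q = "insert CenterU (LeafV ` {0..<q})"
  have fin: "finite (?E `` {?x})" "finite (?E\<inverse> `` {?y})"
    using G edge_pairs_subset[of G]
    by (auto simp: wf_bigraph_def intro: finite_subset[of _ "rside G"] finite_subset[of _ "lside G"])
  have E: "{CenterU, CenterV} \<in> edges ?H"
    "\<And>i. i < p \<Longrightarrow> {CenterU, LeafU i} \<in> edges ?H"
    "\<And>i. i < q \<Longrightarrow> {LeafV i, CenterV} \<in> edges ?H"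
    by (auto simp: double_star_def insert_commute)
  have sides: "lside ?H = ?Q" "rside ?H = ?P"
    by (auto simp: double_star_def)
  have "f ` ?P \<subseteq> ?E `` {?x}" "f ` ?Q \<subseteq> ?E\<inverse> `` {?y}"
    using l r e[rule_format, OF E(1)] e[rule_format, OF E(2)] e[rule_format, OF E(3)]
    by (auto simp: edge_pairs_def sides)
  then have "card (f ` ?P) \<le> card (?E `` {?x})" "card (f ` ?Q) \<le> card (?E\<inverse> `` {?y})"
    using card_mono[OF fin(1)] card_mono[OF fin(2)] by blast+
  moreover have "card (f ` ?P) = card ?P" "card (f ` ?Q) = card ?Q"
    using inj unfolding sides by (meson card_image inj_on_subset sup_ge1 sup_ge2)+
  moreover have "card ?P = p + 1" "card ?Q = q + 1"
    by (auto simp: card_insert_if card_image inj_on_def)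
  moreover have "(?x, ?y) \<in> ?E"
    using l r e[rule_format, OF E(1)] by (auto simp: edge_pairs_def sides)
  ultimately show thesis
    using that by simp
qed

lemma contains_double_starI:
  assumes G: "wf_bigraph G" and xy: "(x, y) \<in> edge_pairs G"
    and p: "p + 1 \<le> card (edge_pairs G `` {x})" and q: "q + 1 \<le> card ((edge_pairs G)\<inverse> `` {y})"
  shows "contains_bigraph G (double_star p q)"
proof -
  let ?E = "edge_pairs G"
  have disj: "lside G \<inter> rside G = {}"
    using G by (simp add: wf_bigraph_def)
  \<comment> \<open>Leaves are chosen away from the opposite centre \<open>z\<close>, which costs at
    most one neighbour.\<close>
  have enum: "\<exists>g. inj_on g {0..<k} \<and> g ` {0..<k} \<subseteq> S - {z}" if "k + 1 \<le> card S" for S z and k :: nat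
  proof -
    have "k \<le> card (S - {z})"
      using that by (auto simp: card_Diff_singleton_if)
    then obtain T where T: "T \<subseteq> S - {z}" "card T = k" "finite T"
      using obtain_subset_with_card_n by metis
    then obtain g where "bij_betw g {0..<k} T"
      using ex_bij_betw_nat_finite by metis
    then show ?thesis
      using T(1) unfolding bij_betw_def by blast
  qed
  obtain g where g: "inj_on g {0..<p}" "g ` {0..<p} \<subseteq> ?E `` {x} - {y}"
    using enum[OF p] by blast
  obtain h where h: "inj_on h {0..<q}" "h ` {0..<q} \<subseteq> ?E\<inverse> `` {y} - {x}"
    using enum[OF q] by blast
  have gE: "g i \<in> rside G" "{x, g i} \<in> edges G" "g i \<noteq> y" if "i < p" for i
    using subsetD[OF g(2), of "g i"] that by (auto simp: edge_pairs_def)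
  have hE: "h i \<in> lside G" "{h i, y} \<in> edges G" "h i \<noteq> x" if "i < q" for i
    using subsetD[OF h(2), of "h i"] that by (auto simp: edge_pairs_def)
  have xy': "x \<in> lside G" "y \<in> rside G" "{x, y} \<in> edges G"
    using xy by (auto simp: edge_pairs_def)
  define f where "f v = (case v of CenterU \<Rightarrow> x | CenterV \<Rightarrow> y | LeafU i \<Rightarrow> g i | LeafV i \<Rightarrow> h i)" for v
  have f: "f CenterU = x" "f CenterV = y" "f (LeafU i) = g i" "f (LeafV i) = h i" for i
    by (simp_all add: f_def)
  let ?H = "double_star p q"
  have sides: "f ` lside ?H \<subseteq> lside G" "f ` rside ?H \<subseteq> rside G"
    using gE hE xy' by (auto simp: double_star_def f)
  have "f \<circ> LeafU = g" "f \<circ> LeafV = h"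
    by (auto simp: f)
  then have "inj_on f (LeafU ` {0..<p})" "inj_on f (LeafV ` {0..<q})"
    using g(1) h(1) by (simp_all add: inj_on_imageI)
  then have "inj_on f (lside ?H)" "inj_on f (rside ?H)"
    using gE(3) hE(3) by (force simp: double_star_def f)+
  \<comment> \<open>Injectivity is checked on each side; across sides it follows from the
    disjointness of the sides of \<open>G\<close>.\<close>
  moreover have "f ` (lside ?H - rside ?H) \<inter> f ` (rside ?H - lside ?H) = {}"
    using sides disj by blast
  ultimately have "inj_on f (lside ?H \<union> rside ?H)"
    by (simp only: inj_on_Un simp_thms)
  moreover have "\<forall>e\<in>edges ?H. f ` e \<in> edges G"
    using gE(2) hE(2) xy'(3) by (auto simp: double_star_def f insert_commute)
  ultimately show ?thesis
    using sides unfolding contains_bigraph_def by blast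
qed

text \<open>An edge with end degrees \<open>d\<close> and \<open>d'\<close> is the central edge of
  some double star with \<open>i + j = a\<close> iff \<open>d + d' \<ge> a + 2\<close>.\<close>

lemma double_star_free_iff:
  assumes G: "wf_bigraph G"
  shows "(\<forall>H\<in>{double_star i j | i j. i + j = a}. \<not> contains_bigraph G H)
    \<longleftrightarrow> degree_sums_le (a + 1) (edge_pairs G)"
proof
  assume free: "\<forall>H\<in>{double_star i j | i j. i + j = a}. \<not> contains_bigraph G H"
  show "degree_sums_le (a + 1) (edge_pairs G)"
    unfolding degree_sums_le_def
  proof clarify
    fix x y assume xy: "(x, y) \<in> edge_pairs G"
    let ?dx = "card (edge_pairs G `` {x})" and ?dy = "card ((edge_pairs G)\<inverse> `` {y})"
    have fin: "finite (edge_pairs G `` {x})" "finite ((edge_pairs G)\<inverse> `` {y})"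
      using G edge_pairs_subset[of G]
      by (auto simp: wf_bigraph_def intro: finite_subset[of _ "rside G"] finite_subset[of _ "lside G"])
    then have pos: "0 < ?dx" "0 < ?dy"
      using xy by (auto simp: card_gt_0_iff)
    show "?dx + ?dy \<le> a + 1"
    proof (rule ccontr)
      assume "\<not> ?dx + ?dy \<le> a + 1"
      \<comment> \<open>As many leaves as possible go to \<open>x\<close>; the cap \<open>a\<close>
        keeps \<open>i + (a - i) = a\<close>.\<close>
      moreover define i where "i = min (?dx - 1) a"
      ultimately have "i + 1 \<le> ?dx" "(a - i) + 1 \<le> ?dy" "i + (a - i) = a"
        using pos by auto
      then show False
        using contains_double_starI[OF G xy] free by blast
    qed
  qed
next
  assume sums: "degree_sums_le (a + 1) (edge_pairs G)"
  show "\<forall>H\<in>{double_star i j | i j. i + j = a}. \<not> contains_bigraph G H"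
  proof (rule ballI, rule notI)
    fix H assume "H \<in> {double_star i j | i j. i + j = a}" "contains_bigraph G H"
    then obtain i j where ij: "i + j = a" "contains_bigraph G (double_star i j)"
      by blast
    obtain x y where "(x, y) \<in> edge_pairs G" "i + 1 \<le> card (edge_pairs G `` {x})"
      "j + 1 \<le> card ((edge_pairs G)\<inverse> `` {y})"
      using contains_double_starD[OF G ij(2)] .
    then show False
      using sums ij(1) by (fastforce simp: degree_sums_le_def)
  qed
qed

lemma ex_bip_double_stars:
  assumes "1 \<le> a" "a \<le> 2 * n - 2"
  shows "ex_bip n n {double_star i j | i j. i + j = a} = max_edges n (a + 1)"
proof -
  let ?F = "{double_star i j | i j. i + j = a}"
  let ?S = "{card (edges G) | G :: nat bigraph. wf_bigraph G \<and> card (lside G) = n \<and>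
    card (rside G) = n \<and> (\<forall>H\<in>?F. \<not> contains_bigraph G H)}"
  have D: "2 \<le> a + 1" "a + 1 \<le> 2 * n - 1"
    using assms by auto
  have le: "c \<le> max_edges n (a + 1)" if c: "c \<in> ?S" for c
  proof -
    obtain G :: "nat bigraph" where G: "c = card (edges G)" "wf_bigraph G" "card (lside G) = n"
      "card (rside G) = n" "\<forall>H\<in>?F. \<not> contains_bigraph G H"
      using c by blast
    then have "degree_sums_le (a + 1) (edge_pairs G)"
      using double_star_free_iff by blast
    then have "card (edge_pairs G) \<le> max_edges n (a + 1)"
      using G D
      by (intro card_le_max_edges[of "lside G" "rside G"] edge_pairs_subset)
        (auto simp: wf_bigraph_def)
    then show ?thesis
      using G card_edge_pairs by metis
  qed
  obtain B where B: "B \<subseteq> rect n n" "degree_sums_le (a + 1) B" "card B = max_edges n (a + 1)"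
    using exists_max_edges[OF D] .
  \<comment> \<open>The right side is shifted by \<open>n\<close> to make the sides
    disjoint.\<close>
  define G :: "nat bigraph" where "G = \<lparr>lside = {0..<n}, rside = (+) n ` {0..<n},
    edges = (\<lambda>(x, y). {x, n + y}) ` B\<rparr>"
  have wf: "wf_bigraph G"
    using B(1) by (fastforce simp: wf_bigraph_def G_def rect_def)
  have pairs: "edge_pairs G = (\<lambda>(x, y). (x, n + y)) ` B"
    using B(1) by (fastforce simp: edge_pairs_def G_def rect_def doubleton_eq_iff)
  have "card (edges G) = max_edges n (a + 1)"
  proof -
    have "card (edges G) = card ((\<lambda>(x, y). (x, n + y)) ` B)"
      using card_edge_pairs[OF wf] pairs by simp
    also have "\<dots> = card B"
      by (intro card_image) (auto simp: inj_on_def)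
    finally show ?thesis
      using B(3) by simp
  qed
  moreover have "degree_sums_le (a + 1) (edge_pairs G)"
  proof -
    have "edge_pairs G `` {x} = (+) n ` (B `` {x})" "(edge_pairs G)\<inverse> `` {n + y} = B\<inverse> `` {y}" for x y
      by (auto simp: pairs)
    then show ?thesis
      using B(2) by (auto simp: degree_sums_le_def pairs card_image)
  qed
  moreover have "card (lside G) = n" "card (rside G) = n"
    by (simp_all add: G_def card_image)
  ultimately have mem: "max_edges n (a + 1) \<in> ?S"
    unfolding mem_Collect_eq double_star_free_iff[OF wf, symmetric]
    using wf by (intro exI[of _ G]) simp
  \<comment> \<open>There are infinitely many such graphs on natural numbers, but their edge counts
    are bounded, so \<open>Max\<close> is meaningful.\<close>
  have "?S \<subseteq> {..max_edges n (a + 1)}"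
    using le by blast
  then have fin: "finite ?S"
    by (rule finite_subset) simp
  show ?thesis
    unfolding ex_bip_def by (rule Max_eqI[OF fin le mem])
qed

section \<open>Closed forms and the final statement\<close>

lemma real_young_gamma_triangle:
  assumes "1 \<le> k" "k \<le> 2 * n - 2"
  shows "real (young_gamma (triangle k) n n) =
    (if even k then real k * real n / 2
     else if k \<le> n then (real k + 1) / 2 * real n - (real k - 1) / 2
     else (real k - 1) / 2 * real n
       + real_of_int \<lceil>real n * (2 * real n - real k + 1) / (2 * (2 * real n - real k))\<rceil>)"
proof -
  let ?D = "2 * n - k"
  have gamma: "real (young_gamma (triangle k) n n) = real n * real n - real (max_edges n ?D)"
    using young_gamma_triangle[OF assms] by (simp add: of_nat_diff)
  show ?thesis
  proof (cases "even k")
    case True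
    then obtain s where s: "k = 2 * s"
      by (rule evenE)
    then have "?D = 2 * (n - s)"
      by simp
    then have "max_edges n ?D = n * (n - s)"
      by (simp only: max_edges_def) simp
    moreover have "real (n - s) = real n - real s"
      using s assms by (simp add: of_nat_diff)
    ultimately show ?thesis
      using gamma s by (simp add: algebra_simps)
  next
    case False
    then have "odd ?D"
      using assms by simp
    then obtain t where t: "?D = 2 * t + 1"
      by (rule oddE)
    then have k: "real k = 2 * real n - 2 * real t - 1"
      using assms by linarith
    then have t': "real t = real n - (real k + 1) / 2"
      by (simp add: field_simps)
    show ?thesis
    proof (cases "k \<le> n")
      case True
      then have "max_edges n ?D = (n - 1) * (t + 1)"
        using t by (auto simp: max_edges_def)
      moreover have "real ((n - 1) * (t + 1)) = (real n - 1) * (real t + 1)"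
        using assms by (simp only: of_nat_mult of_nat_diff) auto
      ultimately have "real (young_gamma (triangle k) n n)
          = real n * real n - (real n - 1) * (real t + 1)"
        using gamma by (simp only:)
      then show ?thesis
        using True False by (simp add: t' field_simps)
    next
      case k_n: False
      then have max: "max_edges n ?D = n * t + n * t div (2 * t + 1)"
        using t assms by (auto simp: max_edges_def)
      \<comment> \<open>Since \<open>2 * n - k = 2 * t + 1\<close>, the fraction is
        \<open>n * (t + 1) / (2 * t + 1)\<close>. Written as \<open>n\<close> minus a quotient, its
        ceiling becomes \<open>n\<close> minus the integer quotient in
        \<open>max_edges\<close>.\<close>
      have "real n * (2 * real n - real k + 1) / (2 * (2 * real n - real k))
          = - (real (n * t) / real (2 * t + 1)) + of_int (int n)"
        by (simp add: k field_simps)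
      then have "\<lceil>real n * (2 * real n - real k + 1) / (2 * (2 * real n - real k))\<rceil>
          = int n - int (n * t div (2 * t + 1))"
        by (simp only: ceiling_add_of_int ceiling_minus floor_divide_of_nat_eq)
      then show ?thesis
        using gamma max False k_n by (simp add: k field_simps)
    qed
  qed
qed

theorem corollary3p4:
  fixes m n a :: nat
  assumes "m \<ge> 1" and "n \<ge> 1" and "1 \<le> a" and "a \<le> m + n - 2"
  shows "young_dual m n (triangle a \<inter> rect n m) = triangle (m + n - 1 - a) \<inter> rect n m
    \<and> (m = n \<longrightarrow>
        int (ex_bip n n {double_star i j | i j. i + j = a})
          = int n ^ 2 - int (young_gamma (triangle (2 * n - 1 - a)) n n)
        \<and> (\<forall>k. k = 2 * n - 1 - a \<longrightarrow>
            real (young_gamma (triangle k) n n) =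
              (if even k then real k * real n / 2
               else if k \<le> n then (real k + 1) / 2 * real n - (real k - 1) / 2
               else (real k - 1) / 2 * real n
                    + real_of_int \<lceil>real n * (2 * real n - real k + 1)
                                     / (2 * (2 * real n - real k))\<rceil>)))"
proof (intro conjI impI allI)
  show "young_dual m n (triangle a \<inter> rect n m) = triangle (m + n - 1 - a) \<inter> rect n m"
    by (rule young_dual_triangle[OF assms])
next
  assume "m = n"
  \<comment> \<open>By \<open>D\<close>, domination with \<open>k = 2 * n - 1 - a\<close> and the
    double stars with \<open>i + j = a\<close> share the degree-sum bound
    \<open>a + 1\<close>.\<close>
  then have a: "a \<le> 2 * n - 2" and k: "1 \<le> 2 * n - 1 - a" "2 * n - 1 - a \<le> 2 * n - 2"
    and D: "2 * n - (2 * n - 1 - a) = a + 1"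
    using assms by auto
  show "int (ex_bip n n {double_star i j | i j. i + j = a})
      = int n ^ 2 - int (young_gamma (triangle (2 * n - 1 - a)) n n)"
    using ex_bip_double_stars[OF assms(3) a] young_gamma_triangle[OF k, unfolded D]
    by (simp add: power2_eq_square of_nat_diff)
next
  fix k assume "m = n" "k = 2 * n - 1 - a"
  then have "1 \<le> k" "k \<le> 2 * n - 2"
    using assms by auto
  then show "real (young_gamma (triangle k) n n) =
              (if even k then real k * real n / 2
               else if k \<le> n then (real k + 1) / 2 * real n - (real k - 1) / 2
               else (real k - 1) / 2 * real n
                    + real_of_int \<lceil>real n * (2 * real n - real k + 1)
                                     / (2 * (2 * real n - real k))\<rceil>)"
    by (rule real_young_gamma_triangle)
qed

end
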